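(* Let $K$ be a field of characteristic $0$, let $m,r$ be positive integers, and let $\alpha_1,\ldots,\alpha_m\in K^\times$ be pairwise distinct. Let $n,\ell$ be nonnegative integers and let $$R_n=L_{(m+1)^{r-1}n}\,L_{(m+1)^{r-2}n}\cdots L_{(m+1)n}\,L_n\in K[z,\partial_z],\qquad L_N=\frac1{N!}z^N\prod_{i=1}^m(z-\alpha_i)^N\partial_z^N .$$ Define $$P_{n,\ell}(z)=\bigl(R_n^*\cdot t^\ell\bigr)\big|_{t=z},\qquad Q_{n,\boldsymbol{s},\boldsymbol{a},\ell}(z)=\varphi_{\boldsymbol{s},\boldsymbol{a}}\!\left(\frac{P_{n,\ell}(z)-P_{n,\ell}(t)}{z-t}\right)\quad\text{for }(\boldsymbol{s},\boldsymbol{a})\in\mathcal{S}.$$ Then $(P_{n,\ell},Q_{n,\boldsymbol{s},\boldsymbol{a},\ell})_{(\boldsymbol{s},\boldsymbol{a})\in\mathcal{S}}$ is a weight $n$ Padé-type approximant of $(f_{\boldsymbol{s},\boldsymbol{a}}(z))_{(\boldsymbol{s},\boldsymbol{a})\in\mathcal{S}}$.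
   Context: $\mathbb{N}$ is the set of positive integers. $\mathcal{S}$ is the set of pairs $(\boldsymbol{s},\boldsymbol{a})$ with $\boldsymbol{s}=(s_1,\ldots,s_k)\in\mathbb{N}^k$, $\boldsymbol{a}=(\alpha_{i_1},\ldots,\alpha_{i_k})\in\{\alpha_1,\ldots,\alpha_m\}^k$, $1\le k\le r$, and $s_1+\cdots+s_k\le r$; it has $M=(m+1)^r-1$ elements. For such a pair, $$f_{\boldsymbol{s},\boldsymbol{a}}(z)=\mathrm{Li}_{\boldsymbol{s}}(\alpha_{i_1}/\alpha_{i_2},\ldots,\alpha_{i_{k-1}}/\alpha_{i_k},\alpha_{i_k}/z)=\sum_{0<n_1<\cdots<n_k}\frac{\alpha_{i_1}^{n_1}\alpha_{i_2}^{n_2-n_1}\cdots\alpha_{i_k}^{n_k-n_{k-1}}}{n_1^{s_1}\cdots n_k^{s_k}}\,z^{-n_k}\in\tfrac1zK[[1/z]].$$ For $f=\sum_{k\ge0}f_kz^{-k-1}\in\frac1zK[[1/z]]$, $\varphi_f:K[t]\to K$ is the $K$-linear map $t^k\mapsto f_k$, extended $K[z]$-linearly to $K[z][t]$; $\varphi_{\boldsymbol{s},\boldsymbol{a}}:=\varphi_{f_{\boldsymbol{s},\boldsymbol{a}}}$. $K[z,\partial_z]$ is the Weyl algebra; the formal adjoint of $R=\sum_jP_j(z)\partial_z^j$ is $R^*=\sum_j(-1)^j\partial_t^jP_j(t)\in K[t,\partial_t]$, acting on $K[t]$. The order is $\mathrm{ord}_\infty(\sum_ka_kz^{-k})=\min\{k:a_k\ne0\}$.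 A tuple $(P,Q_1,\ldots,Q_M)\in K[z]^{M+1}$ is a weight $n$ Padé-type approximant of $(f_1,\ldots,f_M)$ if, for some integer $D\ge Mn$, $\deg P\le D$ and $\mathrm{ord}_\infty(Pf_j-Q_j)\ge n+1$ for all $j$. *)

theory Defs
  imports "HOL-Computational_Algebra.Computational_Algebra" "HOL-Library.Extended_Real"
begin

section \<open>The Weyl algebra\<close>

text \<open>
  An element \<open>\<Sum>j. P\<^sub>j(z) \<partial>\<^sup>j\<close> is stored in this normal form: the outer indeterminate of
  \<open>'a poly poly\<close> is \<open>\<partial>\<close>, and the coefficient of its \<open>j\<close>-th power is \<open>P\<^sub>j\<close>.
\<close>

typedef (overloaded) 'a weyl = "UNIV :: 'a::field_char_0 poly poly set"
  morphisms weyl_coeffs Weyl ..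

lemma weyl_coeffs_Weyl [simp]: "weyl_coeffs (Weyl A) = A"
  by (simp add: Weyl_inverse)

lemma Weyl_inject_iff [simp]: "Weyl A = Weyl B \<longleftrightarrow> A = B"
  by (simp add: Weyl_inject)

lemma weyl_exhaust [cases type: weyl]: obtains A where "R = Weyl A"
  by (metis weyl_coeffs_inverse)

definition weyl_act :: "'a::field_char_0 weyl \<Rightarrow> 'a poly \<Rightarrow> 'a poly" where
  "weyl_act R p = (\<Sum>j\<le>degree (weyl_coeffs R). coeff (weyl_coeffs R) j * (pderiv ^^ j) p)"

instantiation weyl :: (field_char_0) "{zero, one, plus, minus, uminus, times}"
begin

definition zero_weyl :: "'a weyl" where "0 = Weyl 0"
definition one_weyl :: "'a weyl" where "1 = Weyl 1"
definition plus_weyl :: "'a weyl \<Rightarrow> 'a weyl \<Rightarrow> 'a weyl"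
  where "R + S = Weyl (weyl_coeffs R + weyl_coeffs S)"
definition minus_weyl :: "'a weyl \<Rightarrow> 'a weyl \<Rightarrow> 'a weyl"
  where "R - S = Weyl (weyl_coeffs R - weyl_coeffs S)"
definition uminus_weyl :: "'a weyl \<Rightarrow> 'a weyl"
  where "- R = Weyl (- weyl_coeffs R)"

text \<open>
  The product follows from \<open>\<partial>\<^sup>i Q = (\<Sum>k\<le>i. (i choose k) Q\<^sup>(\<^sup>k\<^sup>) \<partial>\<^sup>i\<^sup>-\<^sup>k)\<close>; it is the unique one for
  which \<open>weyl_act\<close> turns products into compositions (\<open>weyl_act_mult\<close> and \<open>weyl_act_inject\<close> below).
\<close>

definition times_weyl :: "'a weyl \<Rightarrow> 'a weyl \<Rightarrow> 'a weyl" where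
  "R * S = Weyl (\<Sum>i\<le>degree (weyl_coeffs R). \<Sum>j\<le>degree (weyl_coeffs S). \<Sum>k\<le>i.
     monom (of_nat (i choose k) * coeff (weyl_coeffs R) i * (pderiv ^^ k) (coeff (weyl_coeffs S) j))
       (i - k + j))"

instance ..

end

lemma weyl_act_bound:
  assumes "degree A \<le> n"
  shows "weyl_act (Weyl A) p = (\<Sum>j\<le>n. coeff A j * (pderiv ^^ j) p)"
  unfolding weyl_act_def weyl_coeffs_Weyl
  by (rule sum.mono_neutral_left) (use assms in \<open>auto simp: coeff_eq_0\<close>)

lemma funpow_pderiv_add: "(pderiv ^^ n) (p + q) = (pderiv ^^ n) p + (pderiv ^^ n) (q :: 'a::field_char_0 poly)"
  by (induction n) (auto simp: pderiv_add)

lemma funpow_pderiv_0: "(pderiv ^^ n) 0 = (0 :: 'a::field_char_0 poly)"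
  by (induction n) auto

lemma funpow_pderiv_sum: "(pderiv ^^ n) (sum f A) = (\<Sum>x\<in>A. (pderiv ^^ n) (f x :: 'a::field_char_0 poly))"
  by (induction A rule: infinite_finite_induct) (auto simp: funpow_pderiv_0 funpow_pderiv_add)

lemma funpow_pderiv_Leibniz:
  fixes p q :: "'a::field_char_0 poly"
  shows "(pderiv ^^ n) (p * q) =
    (\<Sum>k\<le>n. of_nat (n choose k) * (pderiv ^^ k) p * (pderiv ^^ (n - k)) q)"
proof (induction n)
  case (Suc n)
  define F where "F a b = (pderiv ^^ a) p * (pderiv ^^ b) q" for a b
  have dF: "pderiv (F a b) = F (Suc a) b + F a (Suc b)" for a b
    by (simp add: F_def pderiv_mult algebra_simps)
  have dc: "pderiv (of_nat c * X) = of_nat c * pderiv X" for c and X :: "'a poly"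
    by (simp add: of_nat_poly pderiv_smult)
  have ps: "pderiv (sum h A) = (\<Sum>x\<in>A. pderiv (h x))" for h :: "nat \<Rightarrow> 'a poly" and A
    using funpow_pderiv_sum[of 1] by simp
  have "(pderiv ^^ Suc n) (p * q) = pderiv (\<Sum>k\<le>n. of_nat (n choose k) * F k (n - k))"
    by (simp add: Suc F_def mult.assoc)
  also have "\<dots> = (\<Sum>k\<le>n. of_nat (n choose k) * F (Suc k) (n - k))
        + (\<Sum>k\<le>n. of_nat (n choose k) * F k (Suc (n - k)))"
    by (simp add: ps dc dF distrib_left sum.distrib)
  also have "(\<Sum>k\<le>n. of_nat (n choose k) * F k (Suc (n - k))) =
     (\<Sum>k\<le>Suc n. of_nat (n choose k) * F k (Suc n - k))"
    by (simp add: Suc_diff_le)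
  also have "\<dots> = F 0 (Suc n) + (\<Sum>k\<le>n. of_nat (n choose Suc k) * F (Suc k) (n - k))"
    by (subst sum.atMost_Suc_shift) simp
  also have "(\<Sum>k\<le>n. of_nat (n choose k) * F (Suc k) (n - k)) +
      (F 0 (Suc n) + (\<Sum>k\<le>n. of_nat (n choose Suc k) * F (Suc k) (n - k)))
    = F 0 (Suc n) + (\<Sum>k\<le>n. of_nat (Suc n choose Suc k) * F (Suc k) (n - k))"
    by (simp add: sum.distrib distrib_right)
  also have "\<dots> = (\<Sum>k\<le>Suc n. of_nat (Suc n choose k) * F k (Suc n - k))"
    by (subst sum.atMost_Suc_shift) simp
  finally show ?case by (simp add: F_def mult.assoc)
qed simp

lemma weyl_act_plus: "weyl_act (R + S) p = weyl_act R p + weyl_act S p"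
proof (cases R; cases S)
  fix A B assume RS: "R = Weyl A" "S = Weyl B"
  let ?n = "max (degree A) (degree B)"
  have "degree (A + B) \<le> ?n" by (simp add: degree_add_le_max)
  then show ?thesis
    by (simp add: RS plus_weyl_def weyl_act_bound[of _ ?n] algebra_simps sum.distrib)
qed

lemma weyl_act_uminus: "weyl_act (- R) p = - weyl_act R p"
  by (simp add: uminus_weyl_def weyl_act_def sum_negf)

lemma weyl_act_minus: "weyl_act (R - S) p = weyl_act R p - weyl_act S p"
proof -
  have "R - S = R + - S" by (simp add: minus_weyl_def plus_weyl_def uminus_weyl_def)
  then show ?thesis by (simp add: weyl_act_plus weyl_act_uminus)
qed

lemma weyl_act_0: "weyl_act 0 p = 0"
  by (simp add: zero_weyl_def weyl_act_def)

lemma weyl_act_1: "weyl_act 1 p = p"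
  by (simp add: one_weyl_def weyl_act_def)

lemma weyl_act_monom: "weyl_act (Weyl (monom c d)) p = c * (pderiv ^^ d) p"
proof -
  have "weyl_act (Weyl (monom c d)) p = (\<Sum>j\<le>d. coeff (monom c d) j * (pderiv ^^ j) p)"
    by (rule weyl_act_bound) (rule degree_monom_le)
  also have "\<dots> = (\<Sum>j\<le>d. if j = d then c * (pderiv ^^ d) p else 0)"
    by (rule sum.cong) auto
  finally show ?thesis by simp
qed

lemma weyl_act_Weyl_sum: "weyl_act (Weyl (\<Sum>x\<in>A. f x)) p = (\<Sum>x\<in>A. weyl_act (Weyl (f x)) p)"
proof (induction A rule: infinite_finite_induct)
  case (insert x F)
  then show ?case using weyl_act_plus[of "Weyl (f x)" "Weyl (sum f F)"] by (simp add: plus_weyl_def)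
qed (auto simp: weyl_act_0[unfolded zero_weyl_def])

lemma weyl_act_mult: "weyl_act (R * S) p = weyl_act R (weyl_act S p)"
proof (cases R; cases S)
  fix A B assume RS: "R = Weyl A" "S = Weyl B"
  have fp: "(pderiv ^^ i) ((pderiv ^^ j) p) = (pderiv ^^ (i + j)) p" for i j
    by (simp add: funpow_add)
  have "weyl_act R (weyl_act S p) =
    (\<Sum>i\<le>degree A. coeff A i * (\<Sum>j\<le>degree B. \<Sum>k\<le>i.
       of_nat (i choose k) * (pderiv ^^ k) (coeff B j) * (pderiv ^^ (i - k + j)) p))"
    by (simp add: RS weyl_act_def funpow_pderiv_sum funpow_pderiv_Leibniz fp)
  then show ?thesis
    by (simp add: RS times_weyl_def weyl_act_Weyl_sum weyl_act_monom sum_distrib_left mult_ac)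
qed

lemma funpow_pderiv_monom_self: "(pderiv ^^ i) (monom 1 i) = (of_nat (fact i) :: 'a::field_char_0 poly)"
proof -
  have "(pderiv ^^ k) (monom c (k + j)) = monom (pochhammer (of_nat (Suc j)) k * c) j" for k j and c :: 'a
  proof (induction k arbitrary: c)
    case (Suc k)
    have "(pderiv ^^ Suc k) (monom c (Suc k + j)) = (pderiv ^^ k) (monom (of_nat (Suc k + j) * c) (k + j))"
      by (simp add: funpow_Suc_right pderiv_monom del: funpow.simps)
    also have "\<dots> = monom (pochhammer (of_nat (Suc j)) k * (of_nat (Suc k + j) * c)) j" by (rule Suc)
    finally show ?case by (simp add: pochhammer_Suc algebra_simps del: funpow.simps)
  qed simp
  from this[of i 1 0] show ?thesis
    by (simp add: monom_0 pochhammer_fact[symmetric] of_nat_poly)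
qed

lemma funpow_pderiv_monom_0: "j > i \<Longrightarrow> (pderiv ^^ j) (monom 1 i) = (0 :: 'a::field_char_0 poly)"
proof -
  assume "j > i"
  then obtain d where d: "j = d + Suc i" by (metis add.commute less_imp_add_positive add_Suc_right gr0_implies_Suc)
  have "(pderiv ^^ Suc i) (monom 1 i) = (0 :: 'a poly)"
    using funpow_pderiv_monom_self[of i, where 'a='a] by (simp add: of_nat_poly pderiv_pCons)
  then show ?thesis unfolding d funpow_add o_apply by (simp only: funpow_pderiv_0)
qed

lemma weyl_act_inject: "weyl_act R = weyl_act S \<Longrightarrow> R = S"
proof (rule ccontr)
  assume eq: "weyl_act R = weyl_act S" and ne: "R \<noteq> S"
  define A where "A = weyl_coeffs (R - S)"
  have act0: "weyl_act (Weyl A) p = 0" for p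
    using fun_cong[OF eq, of p] weyl_act_minus[of R S p] by (simp add: A_def weyl_coeffs_inverse)
  have "A \<noteq> 0" using ne by (cases R; cases S) (auto simp: A_def minus_weyl_def)
  then have ex: "\<exists>i. coeff A i \<noteq> 0" by (metis leading_coeff_0_iff)
  define i where "i = (LEAST i. coeff A i \<noteq> 0)"
  have i: "coeff A i \<noteq> 0" using LeastI_ex[OF ex] by (simp add: i_def)
  have lt: "coeff A j = 0" if "j < i" for j using not_less_Least[of j] that by (auto simp: i_def)
  have "0 = (\<Sum>j\<le>degree A. coeff A j * (pderiv ^^ j) (monom 1 i))"
    using act0[of "monom 1 i"] by (simp add: weyl_act_def)
  also have "\<dots> = (\<Sum>j\<in>{i}. coeff A j * (pderiv ^^ j) (monom 1 i))"
  proof (rule sum.mono_neutral_right)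
    show "\<forall>j\<in>{..degree A} - {i}. coeff A j * (pderiv ^^ j) (monom 1 i) = 0"
    proof
      fix j assume "j \<in> {..degree A} - {i}"
      then have "j < i \<or> j > i" by auto
      then show "coeff A j * (pderiv ^^ j) (monom 1 i) = 0"
        using lt funpow_pderiv_monom_0 by auto
    qed
  qed (use i le_degree in auto)
  also have "\<dots> = coeff A i * of_nat (fact i)" by (simp add: funpow_pderiv_monom_self)
  finally show False using i by simp
qed

instance weyl :: (field_char_0) ring_1
proof
  fix a b c :: "'a weyl"
  have add_right: "weyl_act R (p + q) = weyl_act R p + weyl_act R q" for R :: "'a weyl" and p q
    by (simp add: weyl_act_def funpow_pderiv_add distrib_left sum.distrib)
  note act = weyl_act_plus weyl_act_minus weyl_act_uminus weyl_act_0 weyl_act_1 weyl_act_mult add_right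
  show "a + b + c = a + (b + c)" by (rule weyl_act_inject) (simp add: fun_eq_iff act)
  show "a + b = b + a" by (rule weyl_act_inject) (simp add: fun_eq_iff act)
  show "0 + a = a" by (rule weyl_act_inject) (simp add: fun_eq_iff act)
  show "- a + a = 0" by (rule weyl_act_inject) (simp add: fun_eq_iff act)
  show "a - b = a + - b" by (rule weyl_act_inject) (simp add: fun_eq_iff act)
  show "a * b * c = a * (b * c)" by (rule weyl_act_inject) (simp add: fun_eq_iff act)
  show "1 * a = a" by (rule weyl_act_inject) (simp add: fun_eq_iff act)
  show "a * 1 = a" by (rule weyl_act_inject) (simp add: fun_eq_iff act)
  show "(a + b) * c = a * c + b * c" by (rule weyl_act_inject) (simp add: fun_eq_iff act)
  show "a * (b + c) = a * b + a * c" by (rule weyl_act_inject) (simp add: fun_eq_iff act)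
  show "(0 :: 'a weyl) \<noteq> 1" by (simp add: zero_weyl_def one_weyl_def)
qed

definition weyl_of_poly :: "'a::field_char_0 poly \<Rightarrow> 'a weyl" where
  "weyl_of_poly p = Weyl [:p:]"

definition weyl_D :: "'a::field_char_0 weyl" where
  "weyl_D = Weyl [:0, 1:]"

lemma weyl_act_of_poly: "weyl_act (weyl_of_poly p) q = p * q"
  by (simp add: weyl_act_def weyl_of_poly_def)

lemma weyl_act_D: "weyl_act weyl_D q = pderiv q"
  by (simp add: weyl_act_def weyl_D_def)

definition weyl_adjoint :: "'a::field_char_0 weyl \<Rightarrow> 'a weyl" where
  "weyl_adjoint R = (\<Sum>j\<le>degree (weyl_coeffs R).
     (- 1) ^ j * weyl_D ^ j * weyl_of_poly (coeff (weyl_coeffs R) j))"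


section \<open>Laurent series at infinity\<close>

text \<open>
  Elements of \<open>K((1/z))\<close> are formal Laurent series whose indeterminate \<open>fls_X\<close> stands for \<open>1/z\<close>;
  thus \<open>fls_nth f k\<close> is the coefficient of \<open>z\<^sup>-\<^sup>k\<close>, and \<open>z\<close> itself is \<open>fls_X_inv\<close>.
\<close>

definition poly_at_infty :: "'a::field_char_0 poly \<Rightarrow> 'a fls" where
  "poly_at_infty p = poly (map_poly fls_const p) fls_X_inv"

definition ord_infty :: "'a::field_char_0 fls \<Rightarrow> ereal" where
  "ord_infty f = (if f = 0 then \<infinity> else ereal (real_of_int (fls_subdegree f)))"

definition pade_type_approximant ::
  "nat \<Rightarrow> 'j set \<Rightarrow> ('j \<Rightarrow> 'a::field_char_0 fls) \<Rightarrow> 'a poly \<Rightarrow> ('j \<Rightarrow> 'a poly) \<Rightarrow> bool" where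
  "pade_type_approximant n J f P Q \<longleftrightarrow> finite J \<and>
     (\<exists>D. D \<ge> card J * n \<and> degree P \<le> D \<and>
       (\<forall>j\<in>J. ord_infty (poly_at_infty P * f j - poly_at_infty (Q j)) \<ge> ereal (real n + 1)))"

text \<open>
  The functional \<open>\<phi>\<^sub>f\<close>, \<open>t\<^sup>k \<mapsto> f\<^sub>k\<close> for \<open>f = (\<Sum>k. f\<^sub>k z\<^sup>-\<^sup>k\<^sup>-\<^sup>1)\<close>, and its \<open>K[z]\<close>-linear extension to
  \<open>K[z][t]\<close>, which is \<open>'a poly poly\<close> with outer indeterminate \<open>t\<close>.
\<close>

definition phi :: "'a::field_char_0 fls \<Rightarrow> 'a poly \<Rightarrow> 'a" where
  "phi f p = (\<Sum>k\<le>degree p. coeff p k * fls_nth f (int k + 1))"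

definition phi_ext :: "'a::field_char_0 fls \<Rightarrow> 'a poly poly \<Rightarrow> 'a poly" where
  "phi_ext f p = (\<Sum>k\<le>degree p. coeff p k * [:phi f (monom 1 k):])"

text \<open>\<open>(P(z) - P(t)) / (z - t)\<close> in \<open>K[z][t]\<close>; the division is exact.\<close>

definition divided_difference :: "'a::field_char_0 poly \<Rightarrow> 'a poly poly" where
  "divided_difference P = ([:P:] - map_poly (\<lambda>c. [:c:]) P) div [:[:0, 1:], - 1:]"

lemma divided_difference_exact:
  "divided_difference P * [:[:0, 1:], - 1:] = [:P:] - map_poly (\<lambda>c. [:c:]) P"
proof -
  have "poly (map_poly (\<lambda>c. [:c:]) P) [:0, 1:] = P"
    by (induction P) (auto simp: map_poly_pCons)
  then have "poly ([:P:] - map_poly (\<lambda>c. [:c:]) P) [:0, 1:] = 0"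
    by simp
  then have "[:- [:0, 1:], 1:] dvd [:P:] - map_poly (\<lambda>c. [:c:]) P"
    by (simp only: poly_eq_0_iff_dvd)
  then have "- [:- [:0, 1:], 1:] dvd [:P:] - map_poly (\<lambda>c. [:c:]) P"
    by (simp only: minus_dvd_iff)
  moreover have "- [:- [:0, 1:], 1:] = [:[:0, 1:], - 1 :: 'a poly:]" by simp
  ultimately have "[:[:0, 1:], - 1:] dvd [:P:] - map_poly (\<lambda>c. [:c:]) P" by (simp only:)
  then show ?thesis unfolding divided_difference_def by (rule dvd_div_mult_self)
qed


section \<open>Multiple polylogarithms and the approximants\<close>

text \<open>
  \<open>(s, a)\<close> is a pair of lists of equal length \<open>k\<close>. In \<open>polylog_series\<close> the list \<open>ns\<close> runs over
  \<open>0 < n\<^sub>1 < \<dots> < n\<^sub>k = N\<close>, a finite set; prefixing \<open>0\<close> supplies \<open>n\<^sub>0 = 0\<close> in the exponent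
  \<open>n\<^sub>j - n\<^sub>j\<^sub>-\<^sub>1\<close>.
\<close>

definition polylog_index :: "(nat \<Rightarrow> 'a) \<Rightarrow> nat \<Rightarrow> nat \<Rightarrow> (nat list \<times> 'a list) set" where
  "polylog_index \<alpha> m r = {(s, a). length s = length a \<and> 1 \<le> length s \<and> length s \<le> r \<and>
     (\<forall>x\<in>set s. x \<ge> 1) \<and> sum_list s \<le> r \<and> set a \<subseteq> \<alpha> ` {1..m}}"

definition increasing_lists :: "nat \<Rightarrow> nat \<Rightarrow> nat list set" where
  "increasing_lists k N =
     {ns. length ns = k \<and> (\<forall>x\<in>set ns. x > 0) \<and> sorted_wrt (<) ns \<and> ns \<noteq> [] \<and> last ns = N}"

definition polylog_series :: "nat list \<Rightarrow> 'a::field_char_0 list \<Rightarrow> 'a fls" where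
  "polylog_series s a = fps_to_fls (Abs_fps (\<lambda>N.
     \<Sum>ns\<in>increasing_lists (length s) N.
       (\<Prod>j<length s. a ! j ^ (ns ! j - (0 # ns) ! j)) / (\<Prod>j<length s. of_nat (ns ! j) ^ (s ! j))))"

definition L_op :: "(nat \<Rightarrow> 'a::field_char_0) \<Rightarrow> nat \<Rightarrow> nat \<Rightarrow> 'a weyl" where
  "L_op \<alpha> m N = weyl_of_poly (smult (1 / fact N) (monom 1 N * (\<Prod>i=1..m. [:- \<alpha> i, 1:] ^ N))) * weyl_D ^ N"

text \<open>The Weyl algebra is not commutative: the factor with index \<open>(m+1)\<^sup>r\<^sup>-\<^sup>1 n\<close> comes first.\<close>

definition R_op :: "(nat \<Rightarrow> 'a::field_char_0) \<Rightarrow> nat \<Rightarrow> nat \<Rightarrow> nat \<Rightarrow> 'a weyl" where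
  "R_op \<alpha> m r n = prod_list (map (\<lambda>j. L_op \<alpha> m ((m + 1) ^ j * n)) (rev [0..<r]))"

definition P_approx :: "(nat \<Rightarrow> 'a::field_char_0) \<Rightarrow> nat \<Rightarrow> nat \<Rightarrow> nat \<Rightarrow> nat \<Rightarrow> 'a poly" where
  "P_approx \<alpha> m r n l = weyl_act (weyl_adjoint (R_op \<alpha> m r n)) (monom 1 l)"

definition Q_approx ::
  "(nat \<Rightarrow> 'a::field_char_0) \<Rightarrow> nat \<Rightarrow> nat \<Rightarrow> nat \<Rightarrow> nat list \<Rightarrow> 'a list \<Rightarrow> nat \<Rightarrow> 'a poly" where
  "Q_approx \<alpha> m r n s a l = phi_ext (polylog_series s a) (divided_difference (P_approx \<alpha> m r n l))"

lemma finite_increasing_lists: "finite (increasing_lists k N)"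
proof (rule finite_subset)
  show "increasing_lists k N \<subseteq> {ns. set ns \<subseteq> {..N} \<and> length ns = k}"
  proof safe
    fix ns x assume ns: "ns \<in> increasing_lists k N" and x: "x \<in> set ns"
    have "ns = butlast ns @ [N]" "sorted_wrt (<) ns" using ns append_butlast_last_id[of ns]
      by (auto simp: increasing_lists_def)
    then have "\<forall>y\<in>set (butlast ns). y < N" by (metis sorted_wrt_append list.set_intros(1))
    then show "x \<le> N" using x \<open>ns = butlast ns @ [N]\<close>
      by (metis Un_iff empty_iff insert_iff less_imp_le list.set(1) list.set(2) order_refl set_append)
  qed (auto simp: increasing_lists_def)
qed (simp add: finite_lists_length_eq)

lemma length_le_sum_list: "\<forall>x\<in>set s. x \<ge> 1 \<Longrightarrow> length s \<le> sum_list (s :: nat list)"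
  by (induction s) auto

lemma card_polylog_index:
  assumes "inj_on \<alpha> {1..m}"
  shows "finite (polylog_index \<alpha> m r) \<and> card (polylog_index \<alpha> m r) = (m + 1) ^ r - 1"
proof -
  define T where "T q = {(s, a). length s = length a \<and>
     (\<forall>x\<in>set s. x \<ge> 1) \<and> sum_list s \<le> q \<and> set a \<subseteq> \<alpha> ` {1..m}}" for q :: nat
  define inc where "inc = (\<lambda>(s, a :: 'a list). (case s of [] \<Rightarrow> [] | x # xs \<Rightarrow> Suc x # xs, a))"
  define cons1 where "cons1 = (\<lambda>(b :: 'a, (s, a)). ((1::nat) # s, b # a))"
  have T: "finite (T q) \<and> card (T q) = (m + 1) ^ q" for q
  proof (induction q)
    case 0
    have "T 0 = {([], [])}"
    proof -
      have "s = [] \<and> a = []" if "(s, a) \<in> T 0" for s a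
      proof -
        have "length s \<le> sum_list s" using that by (intro length_le_sum_list) (auto simp: T_def)
        moreover have "sum_list s \<le> 0" "length s = length a" using that by (simp_all add: T_def)
        ultimately have "length s = 0" "length a = 0" by linarith+
        then show ?thesis by simp
      qed
      then show ?thesis by (auto simp: T_def)
    qed
    then show ?case by simp
  next
    case (Suc q)
    have "T (Suc q) \<subseteq> inc ` T q \<union> cons1 ` (\<alpha> ` {1..m} \<times> T q)"
    proof
      fix p assume p: "p \<in> T (Suc q)"
      obtain s a where sa: "p = (s, a)" by (cases p)
      show "p \<in> inc ` T q \<union> cons1 ` (\<alpha> ` {1..m} \<times> T q)"
      proof (cases s)
        case Nil
        then have "p = inc ([], [])" "([], []) \<in> T q" using p by (auto simp: sa T_def inc_def)
        then show ?thesis by blast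
      next
        case (Cons x xs)
        then obtain b bs where a: "a = b # bs" using p by (cases a) (auto simp: sa T_def)
        show ?thesis
        proof (cases "x = 1")
          case True
          then have "p = cons1 (b, (xs, bs))" "(b, (xs, bs)) \<in> \<alpha> ` {1..m} \<times> T q"
            using p Cons a by (auto simp: sa T_def cons1_def)
          then show ?thesis by blast
        next
          case False
          then have "p = inc ((x - 1) # xs, a)" "((x - 1) # xs, a) \<in> T q"
            using p Cons a by (auto simp: sa T_def inc_def)
          then show ?thesis by blast
        qed
      qed
    qed
    moreover have "inc ` T q \<subseteq> T (Suc q)"
      by (auto simp: T_def inc_def split: list.splits)
    moreover have "cons1 ` (\<alpha> ` {1..m} \<times> T q) \<subseteq> T (Suc q)"
      by (auto simp: T_def cons1_def)
    ultimately have eq: "T (Suc q) = inc ` T q \<union> cons1 ` (\<alpha> ` {1..m} \<times> T q)" by blast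
    have disj: "inc ` T q \<inter> cons1 ` (\<alpha> ` {1..m} \<times> T q) = {}"
      by (auto simp: T_def inc_def cons1_def split: list.splits)
    have i1: "inj_on inc (T q)" by (auto simp: inj_on_def inc_def split: list.splits)
    have i2: "inj_on cons1 (\<alpha> ` {1..m} \<times> T q)" by (auto simp: inj_on_def cons1_def)
    have cA: "card (\<alpha> ` {1..m}) = m" using assms by (simp add: card_image)
    have c2: "card (cons1 ` (\<alpha> ` {1..m} \<times> T q)) = m * card (T q)"
      unfolding card_image[OF i2] card_cartesian_product cA ..
    have "card (T (Suc q)) = card (T q) + m * card (T q)"
      unfolding eq using Suc disj c2 card_image[OF i1]
      by (subst card_Un_disjoint) simp_all
    then show ?case using Suc by (simp add: eq)
  qed
  have "polylog_index \<alpha> m r = T r - {([], [])}"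
  proof -
    have "length s \<le> r" if "(s, a) \<in> T r" for s a
      using length_le_sum_list[of s] that by (auto simp: T_def)
    moreover have "1 \<le> length s \<longleftrightarrow> s \<noteq> []" for s :: "nat list" by (cases s) auto
    ultimately show ?thesis by (auto simp: T_def polylog_index_def)
  qed
  moreover have "([], []) \<in> T r" by (simp add: T_def)
  ultimately show ?thesis using T[of r] by simp
qed

end

theory Submission
  imports Defs
begin

text \<open>
  Since \<open>D\<close> in the definition of a Pade-type approximant may be as large as one likes, all the
  content is in the orders. The coefficient of \<open>z\<^sup>-\<^sup>k\<^sup>-\<^sup>1\<close> in \<open>P f - Q\<close> is \<open>\<phi>\<^sub>f(t\<^sup>k P)\<close> for \<open>k \<ge> 0\<close>, and the
  polynomial part of \<open>P f\<close> is exactly \<open>Q\<close> (\<open>fls_nth_pade_remainder\<close>). So the statement is that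
  every polylogarithmic functional of weight at most \<open>r\<close> kills \<open>t\<^sup>k P\<close> for \<open>k < n\<close>.

  Analytically this holds because differentiating a polylogarithm lowers its weight: with
  \<open>T = z \<Prod>(z - \<alpha>\<^sub>i)\<close>, the function \<open>T \<partial> f\<close> is a polynomial of degree at most \<open>m\<close> times a
  polylogarithm of smaller weight, the constant \<open>1\<close> being the one of weight \<open>0\<close>. Hence if \<open>p\<close> has degree below \<open>N\<close>, the operator \<open>T\<^sup>N \<partial>\<^sup>N\<close> turns
  \<open>p f\<close> into a combination of polylogarithms of smaller weight with coefficients of degree below
  \<open>(m+1) N\<close>; the term in which all \<open>N\<close> derivatives fall on \<open>p\<close> is the only one that keeps \<open>f\<close>, and it
  vanishes. The next factor of \<open>R\<^sub>n\<close> is \<open>L\<close> with index \<open>(m+1) N\<close>, so the argument repeats, and after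
  \<open>r\<close> factors the weight has dropped to \<open>0\<close>, where only polynomials are left.

  The proof carries this out on the dual side, where no operators on Laurent series are needed. There
  \<open>\<partial>\<close> acts on functionals by \<open>\<phi> \<mapsto> - \<phi> \<circ> \<partial>\<close>, polynomials act by multiplication of the argument, and series
  that differ by a polynomial give the same functional. The drop in weight becomes
  \<open>\<phi>\<^sub>w((T u)') = \<phi>\<^sub>w\<^sub>'(c u)\<close> with \<open>w'\<close> of smaller weight and \<open>deg c \<le> m\<close> (\<open>phi_polylog_lower_weight\<close>,
  \<open>phi_polylog_lower_depth\<close>); \<open>phi_by_parts\<close> iterates it, \<open>annihilated_L_adj\<close> is one factor of
  \<open>R\<^sub>n\<close>, and \<open>annihilated_R_adj\<close> is the whole product.
\<close>


section \<open>The functionals \<open>\<phi>\<^sub>f\<close>\<close>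

lemma phi_bound:
  assumes "degree p \<le> d"
  shows "phi f p = (\<Sum>k\<le>d. coeff p k * fls_nth f (int k + 1))"
  unfolding phi_def
  by (rule sum.mono_neutral_left) (use assms in \<open>auto simp: coeff_eq_0\<close>)

lemma phi_add: "phi f (p + q) = phi f p + phi f q"
proof -
  let ?d = "max (degree p) (degree q)"
  have "degree (p + q) \<le> ?d" by (simp add: degree_add_le_max)
  then show ?thesis
    by (simp add: phi_bound[of _ ?d] distrib_right sum.distrib)
qed

lemma phi_smult: "phi f (smult c p) = c * phi f p"
proof -
  have "degree (smult c p) \<le> degree p" by (rule degree_smult_le)
  then show ?thesis
    by (simp add: phi_bound[of _ "degree p"] sum_distrib_left mult.assoc)
qed

lemma phi_0 [simp]: "phi f 0 = 0"
  by (simp add: phi_def)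

lemma phi_minus: "phi f (- p) = - phi f p"
  using phi_smult[of f "- 1" p] by simp

lemma phi_diff: "phi f (p - q) = phi f p - phi f q"
  using phi_add[of f p "- q"] by (simp add: phi_minus)

lemma phi_sum: "phi f (sum g A) = (\<Sum>x\<in>A. phi f (g x))"
  by (induction A rule: infinite_finite_induct) (auto simp: phi_add)

lemma phi_monom: "phi f (monom c k) = c * fls_nth f (int k + 1)"
proof -
  have "phi f (monom c k) = (\<Sum>j\<le>k. coeff (monom c k) j * fls_nth f (int j + 1))"
    by (rule phi_bound) (rule degree_monom_le)
  also have "\<dots> = (\<Sum>j\<le>k. if j = k then c * fls_nth f (int k + 1) else 0)"
    by (rule sum.cong) auto
  finally show ?thesis by simp
qed

lemma poly_monom_induct [case_names monom add]:
  fixes p :: "'a::comm_monoid_add poly"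
  assumes "\<And>c k. P (monom c k)" and "\<And>p q. P p \<Longrightarrow> P q \<Longrightarrow> P (p + q)"
  shows "P p"
proof -
  have "P (\<Sum>i\<le>d. monom (coeff p i) i)" for d
    by (induction d) (auto intro: assms)
  then show ?thesis
    by (metis poly_as_sum_of_monoms)
qed


section \<open>Multiple polylogarithms: lowering the weight\<close>

text \<open>
  The empty index stands for the constant function \<open>1\<close>, whereas \<open>polylog_series [] []\<close> is \<open>0\<close>. With the
  former convention the recursion below also covers depth one. The two agree in all coefficients of
  positive index, which are the only ones that the functional sees.
\<close>

definition polylog_coeff :: "nat list \<Rightarrow> 'a::field_char_0 list \<Rightarrow> nat \<Rightarrow> 'a" where
  "polylog_coeff s a N = (if s = [] then if N = 0 then 1 else 0 else
     \<Sum>ns\<in>increasing_lists (length s) N.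
       (\<Prod>j<length s. a ! j ^ (ns ! j - (0 # ns) ! j)) / (\<Prod>j<length s. of_nat (ns ! j) ^ (s ! j)))"

lemma increasing_lists_0: "increasing_lists 0 N = {}"
  by (auto simp: increasing_lists_def)

lemma fls_nth_polylog_series:
  "fls_nth (polylog_series s a) k = (if k \<le> 0 then 0 else polylog_coeff s a (nat k))"
proof -
  have "increasing_lists j 0 = {}" for j
    by (auto simp: increasing_lists_def) (metis last_in_set less_irrefl)
  then show ?thesis
    by (cases "k = 0") (auto simp: polylog_series_def polylog_coeff_def increasing_lists_0)
qed

lemma increasing_lists_1: "increasing_lists (Suc 0) N = (if N = 0 then {} else {[N]})"
  by (auto simp: increasing_lists_def length_Suc_conv)

lemma increasing_lists_Suc:
  assumes "k > 0"
  shows "increasing_lists (Suc k) N = (\<lambda>ns. ns @ [N]) ` (\<Union>n<N. increasing_lists k n)"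
proof (intro set_eqI iffI)
  fix ns assume ns: "ns \<in> increasing_lists (Suc k) N"
  then have eq: "ns = butlast ns @ [N]"
    using append_butlast_last_id[of ns] by (auto simp: increasing_lists_def)
  have len: "length (butlast ns) = k" using ns by (simp add: increasing_lists_def)
  then have ne: "butlast ns \<noteq> []" using assms by (metis length_0_conv less_irrefl)
  have srt: "sorted_wrt (<) (butlast ns @ [N])" and pos: "\<forall>x\<in>set (butlast ns @ [N]). x > 0"
    using ns eq by (auto simp: increasing_lists_def)
  have "butlast ns \<in> increasing_lists k (last (butlast ns))"
    using len ne srt pos by (auto simp: increasing_lists_def sorted_wrt_append)
  moreover have "last (butlast ns) < N"
    using srt ne by (auto simp: sorted_wrt_append)
  ultimately show "ns \<in> (\<lambda>ns. ns @ [N]) ` (\<Union>n<N. increasing_lists k n)"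
    using eq by blast
next
  fix ns assume "ns \<in> (\<lambda>ns. ns @ [N]) ` (\<Union>n<N. increasing_lists k n)"
  then obtain ms n where ms: "ns = ms @ [N]" "n < N" "ms \<in> increasing_lists k n" by auto
  then have ms': "ms = butlast ms @ [n]" "sorted_wrt (<) ms"
    using append_butlast_last_id[of ms] by (auto simp: increasing_lists_def)
  then have "\<forall>y\<in>set (butlast ms). y < n"
    by (metis sorted_wrt_append list.set_intros(1))
  then have "\<forall>y\<in>set ms. y < N"
    using ms' ms(2) by (metis Un_iff empty_iff insert_iff less_trans list.set(1) list.set(2) set_append)
  then show "ns \<in> increasing_lists (Suc k) N"
    using ms by (auto simp: increasing_lists_def sorted_wrt_append)
qed

text \<open>
  The largest summation index is \<open>n\<^sub>k = N\<close>; fixing the second largest one, \<open>n\<close>, leaves the inner sum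
  of depth \<open>k - 1\<close>.
\<close>

lemma polylog_coeff_snoc:
  fixes a :: "'a::field_char_0 list"
  assumes "length s = length a"
  shows "polylog_coeff (s @ [x]) (a @ [b]) N =
    (\<Sum>n<N. b ^ (N - n) * polylog_coeff s a n) / of_nat N ^ x"
proof (cases "s = []")
  case True
  then have "a = []" using assms by simp
  have "(\<Sum>n<N. b ^ (N - n) * (if n = 0 then 1 else 0)) = (if N = 0 then 0 else b ^ N)"
    by (cases N) (simp_all add: sum.lessThan_Suc_shift del: sum.lessThan_Suc)
  with True \<open>a = []\<close> show ?thesis
    by (simp add: polylog_coeff_def increasing_lists_1)
next
  case False
  define k where "k = length s"
  have k: "k > 0" "length a = k" using False assms by (auto simp: k_def)
  define F where "F ns = (\<Prod>j<k. a ! j ^ (ns ! j - (0 # ns) ! j)) / (\<Prod>j<k. of_nat (ns ! j) ^ (s ! j))"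
    for ns
  define G where "G ns = (\<Prod>j<Suc k. (a @ [b]) ! j ^ (ns ! j - (0 # ns) ! j)) /
    (\<Prod>j<Suc k. of_nat (ns ! j) ^ ((s @ [x]) ! j))" for ns
  have G: "G (ns @ [N]) = b ^ (N - n) * F ns / of_nat N ^ x" if "ns \<in> increasing_lists k n" for ns n
  proof -
    have ns: "length ns = k" "last ns = n" using that by (auto simp: increasing_lists_def)
    have last: "(0 # ns @ [N]) ! k = n"
      using ns k by (cases ns rule: rev_cases) (auto simp: nth_append)
    have "(0 # ns @ [N]) ! j = (0 # ns) ! j" if "j < k" for j
      using that ns by (cases j) (auto simp: nth_append)
    then have "(\<Prod>j<k. (a @ [b]) ! j ^ ((ns @ [N]) ! j - (0 # ns @ [N]) ! j)) =
        (\<Prod>j<k. a ! j ^ (ns ! j - (0 # ns) ! j))"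
      using ns k by (intro prod.cong) (auto simp: nth_append)
    moreover have "(\<Prod>j<k. of_nat ((ns @ [N]) ! j) ^ ((s @ [x]) ! j)) =
        (\<Prod>j<k. of_nat (ns ! j) ^ (s ! j) :: 'a)"
      using ns by (intro prod.cong) (auto simp: nth_append k_def)
    moreover have "(a @ [b]) ! k = b" "(s @ [x]) ! k = x" "(ns @ [N]) ! k = N"
      using k ns by (auto simp: nth_append k_def)
    ultimately show ?thesis
      by (simp add: G_def F_def last)
  qed
  have disj: "increasing_lists k n \<inter> increasing_lists k n' = {}" if "n \<noteq> n'" for n n'
    using that by (auto simp: increasing_lists_def)
  have "polylog_coeff (s @ [x]) (a @ [b]) N = (\<Sum>ns\<in>increasing_lists (Suc k) N. G ns)"
    by (simp add: polylog_coeff_def G_def k_def)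
  also have "\<dots> = (\<Sum>ns\<in>(\<Union>n<N. increasing_lists k n). G (ns @ [N]))"
    using k by (simp add: increasing_lists_Suc sum.reindex inj_on_def)
  also have "\<dots> = (\<Sum>n<N. \<Sum>ns\<in>increasing_lists k n. G (ns @ [N]))"
    using disj by (intro sum.UNION_disjoint) (auto simp: finite_increasing_lists)
  also have "\<dots> = (\<Sum>n<N. b ^ (N - n) * polylog_coeff s a n / of_nat N ^ x)"
    using False by (intro sum.cong refl)
      (simp add: G polylog_coeff_def F_def k_def sum_distrib_left sum_divide_distrib cong: sum.cong)
  finally show ?thesis by (simp add: sum_divide_distrib)
qed

text \<open>
  Dual form of \<open>- z \<partial>\<^sub>z f = f'\<close>, where \<open>f'\<close> has its last exponent lowered by one: on \<open>u = t\<^sup>k\<close> the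
  derivative contributes the factor \<open>k + 1\<close>, which cancels one power of \<open>n\<^sub>k = k + 1\<close>.
\<close>

lemma phi_polylog_lower_weight:
  fixes a :: "'a::field_char_0 list"
  assumes "length a = Suc (length s)"
  shows "phi (polylog_series (s @ [Suc y]) a) (pderiv (pCons 0 u)) = phi (polylog_series (s @ [y]) a) u"
proof -
  obtain a' b where a: "a = a' @ [b]" "length s = length a'"
    using assms by (metis length_Suc_conv_rev)
  have "of_nat (Suc N) * polylog_coeff (s @ [Suc y]) a (Suc N) = polylog_coeff (s @ [y]) a (Suc N)" for N
    using of_nat_neq_0[of N, where 'a='a] unfolding a
    by (simp only: polylog_coeff_snoc[OF a(2)]) (simp add: field_simps del: of_nat_Suc)
  note rec = this
  show ?thesis
  proof (induction u rule: poly_monom_induct)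
    case (monom c k)
    have "pCons 0 (monom c k) = monom c (Suc k)" by (simp add: monom_Suc)
    then show ?case using rec[of k]
      by (simp add: pderiv_monom phi_monom fls_nth_polylog_series nat_add_distrib mult.commute mult.left_commute
        flip: rec del: of_nat_Suc)
  next
    case (add p q)
    have "pCons 0 (p + q) = pCons 0 p + pCons 0 q" by simp
    with add show ?case by (simp add: pderiv_add phi_add del: add_pCons)
  qed
qed

text \<open>
  When the last exponent is \<open>1\<close>, this cancellation leaves \<open>d(N) = (\<Sum>n<N. b\<^sup>N\<^sup>-\<^sup>n c(n))\<close>, and the factor
  \<open>t - b\<close> telescopes it, since \<open>d(N + 1) - b d(N) = b c(N)\<close>. Analytically:
  \<open>- z (z - b) \<partial>\<^sub>z f = b f'\<close>, where \<open>f'\<close> has its last entry removed.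
\<close>

lemma phi_polylog_lower_depth:
  fixes a :: "'a::field_char_0 list"
  assumes "length s = length a"
  shows "phi (polylog_series (s @ [1]) (a @ [b])) (pderiv (pCons 0 ([:- b, 1:] * u)))
    = b * phi (polylog_series s a) u"
proof (induction u rule: poly_monom_induct)
  case (monom c k)
  define d where "d N = (\<Sum>n<N. b ^ (N - n) * polylog_coeff s a n)" for N
  have d: "of_nat (Suc N) * polylog_coeff (s @ [1]) (a @ [b]) (Suc N) = d (Suc N)" for N
    using of_nat_neq_0[of N, where 'a='a]
    by (simp only: polylog_coeff_snoc[OF assms] d_def) (simp add: field_simps del: of_nat_Suc)
  have drec: "d (Suc N) = b * d N + b * polylog_coeff s a N" for N
    by (simp add: d_def sum_distrib_left Suc_diff_le mult.assoc)
  have eq: "pCons 0 ([:- b, 1:] * monom c k) = monom c (Suc (Suc k)) - smult b (monom c (Suc k))"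
    by (simp add: monom_Suc smult_monom minus_monom)
  have "phi (polylog_series (s @ [1]) (a @ [b])) (pderiv (pCons 0 ([:- b, 1:] * monom c k)))
      = c * (of_nat (Suc (Suc k)) * polylog_coeff (s @ [1]) (a @ [b]) (Suc (Suc k)))
        - b * c * (of_nat (Suc k) * polylog_coeff (s @ [1]) (a @ [b]) (Suc k))"
    unfolding eq
    by (simp add: pderiv_diff pderiv_smult pderiv_monom phi_diff phi_smult phi_monom
        fls_nth_polylog_series nat_add_distrib mult_ac del: of_nat_Suc)
  also have "\<dots> = c * (b * polylog_coeff s a (Suc k))"
    unfolding d by (simp add: drec[of "Suc k"] algebra_simps)
  finally show ?case
    by (simp add: phi_monom fls_nth_polylog_series nat_add_distrib)
next
  case (add p q)
  have "pCons 0 ([:- b, 1:] * (p + q)) = pCons 0 ([:- b, 1:] * p) + pCons 0 ([:- b, 1:] * q)"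
    by (simp only: distrib_left add_pCons add_0)
  with add show ?case
    by (simp only: pderiv_add phi_add distrib_left)
qed


section \<open>Annihilation and integration by parts\<close>

definition annihilated :: "(nat \<Rightarrow> 'a::field_char_0) \<Rightarrow> nat \<Rightarrow> nat \<Rightarrow> nat \<Rightarrow> 'a poly \<Rightarrow> bool" where
  "annihilated \<alpha> m q d h \<longleftrightarrow> (\<forall>(s, a)\<in>polylog_index \<alpha> m q. \<forall>p. degree p < d \<longrightarrow>
     phi (polylog_series s a) (p * h) = 0)"

abbreviation sing_poly :: "(nat \<Rightarrow> 'a::field_char_0) \<Rightarrow> nat \<Rightarrow> 'a poly" where
  "sing_poly \<alpha> m \<equiv> pCons 0 (\<Prod>i=1..m. [:- \<alpha> i, 1:])"

lemma degree_sing_poly: "degree (sing_poly \<alpha> m) = Suc m"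
proof -
  have "degree (\<Prod>i=1..m. [:- \<alpha> i, 1:]) = (\<Sum>i=1..m. degree [:- \<alpha> i, 1:])"
    by (rule degree_prod_eq_sum_degree) auto
  moreover have "(\<Prod>i=1..m. [:- \<alpha> i, 1:]) \<noteq> 0" by (auto simp: prod_zero_iff)
  ultimately show ?thesis by simp
qed

lemma annihilatedD: "annihilated \<alpha> m q d h \<Longrightarrow> (s, a) \<in> polylog_index \<alpha> m q \<Longrightarrow> degree p < d \<Longrightarrow>
    phi (polylog_series s a) (p * h) = 0"
  by (auto simp: annihilated_def)

lemma polylog_index_0: "polylog_index \<alpha> m 0 = {}"
proof -
  have False if "(s, a) \<in> polylog_index \<alpha> m 0" for s a
    using that length_le_sum_list[of s] by (auto simp: polylog_index_def)
  then show ?thesis by auto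
qed

text \<open>
  The factor \<open>T = t \<Prod>(t - \<alpha>\<^sub>i)\<close> contains \<open>t\<close> and the \<open>t - b\<close> belonging to any admissible last letter \<open>b\<close>,
  so one of the two lowering rules applies. It uses up \<open>t\<close>, and possibly \<open>t - b\<close>; the remaining
  factors of \<open>T\<close>, at most \<open>m\<close> of them, go into the polynomial multiplier.
\<close>

lemma phi_pderiv_eq_0:
  assumes ann: "annihilated \<alpha> m q (d + m) h"
    and sa: "(s, a) \<in> polylog_index \<alpha> m (Suc q)" and p: "degree p < d"
  shows "phi (polylog_series s a) (pderiv (sing_poly \<alpha> m * p * h)) = 0"
proof -
  define V where "V = (\<Prod>i=1..m. [:- \<alpha> i, 1:])"
  have dV: "degree V = m"
    using degree_sing_poly[of \<alpha> m] by (simp add: V_def split: if_splits)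
  obtain s' x where s: "s = s' @ [x]" using sa by (cases s rule: rev_cases) (auto simp: polylog_index_def)
  obtain a' b where a: "a = a' @ [b]" using sa by (cases a rule: rev_cases) (auto simp: polylog_index_def)
  have len: "length s' = length a'" using sa by (auto simp: polylog_index_def s a)
  have x: "x \<ge> 1" using sa by (auto simp: polylog_index_def s)
  show ?thesis
  proof (cases "x = 1")
    case False
    then obtain y where y: "x = Suc y" "y \<ge> 1" using x by (cases x) auto
    have "(s' @ [y], a) \<in> polylog_index \<alpha> m q"
      using sa y length_le_sum_list[of s'] by (auto simp: polylog_index_def s)
    moreover have "degree (V * p) < d + m"
      using degree_mult_le[of V p] p dV by simp
    ultimately have "phi (polylog_series (s' @ [y]) a) (V * p * h) = 0"
      using ann annihilatedD by blast
    moreover have "pCons 0 V * p * h = pCons 0 (V * p * h)" by simp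
    ultimately show ?thesis
      using phi_polylog_lower_weight[of a s' y "V * p * h"] len
      unfolding s y(1) V_def[symmetric] by (simp add: a)
  next
    case True
    obtain i where i: "i \<in> {1..m}" "b = \<alpha> i" using sa by (auto simp: polylog_index_def a)
    define W where "W = (\<Prod>i\<in>{1..m} - {i}. [:- \<alpha> i, 1:])"
    have V: "V = [:- b, 1:] * W"
      unfolding V_def W_def i(2) using i(1) by (intro prod.remove) auto
    have "W \<noteq> 0" by (auto simp: W_def)
    then have dW: "degree V = degree W + 1" unfolding V by (subst degree_mult_eq) auto
    have "phi (polylog_series s' a') (W * p * h) = 0"
    proof (cases "s' = []")
      case True
      then have "polylog_series s' a' = 0"
        by (intro fls_eqI) (simp add: fls_nth_polylog_series polylog_coeff_def)
      then show ?thesis by (simp add: phi_def)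
    next
      case False
      then have "(s', a') \<in> polylog_index \<alpha> m q"
        using sa x by (auto simp: polylog_index_def s a Suc_le_eq)
      moreover have "degree (W * p) < d + m"
        using degree_mult_le[of W p] p dV dW by simp
      ultimately show ?thesis using ann annihilatedD by blast
    qed
    moreover have "pCons 0 V * p * h = pCons 0 ([:- b, 1:] * (W * p * h))"
      by (simp add: V algebra_simps)
    ultimately show ?thesis
      using phi_polylog_lower_depth[OF len, of b "W * p * h"]
      unfolding s True a V_def[symmetric] by (simp del: mult_pCons_left)
  qed
qed

lemma degree_funpow_pderiv: "degree ((pderiv ^^ j) p) = degree p - j"
  for p :: "'a::field_char_0 poly"
  by (induction j) (auto simp: degree_pderiv)

lemma funpow_pderiv_eq_0:
  fixes p :: "'a::field_char_0 poly"
  assumes "degree p < j"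
  shows "(pderiv ^^ j) p = 0"
proof -
  have "degree ((pderiv ^^ (j - 1)) p) = 0" using assms by (simp add: degree_funpow_pderiv)
  moreover have "(pderiv ^^ j) p = pderiv ((pderiv ^^ (j - 1)) p)" using assms by (cases j) auto
  ultimately show ?thesis by (simp add: pderiv_eq_0_iff)
qed

text \<open>
  All boundary terms of the \<open>j\<close>-fold integration by parts have smaller weight and are killed. The
  powers of \<open>T\<close> and of \<open>\<partial>\<close> have to be removed together: writing \<open>(T\<^sup>j\<^sup>+\<^sup>1 g)' = T\<^sup>j X\<close> with
  \<open>X = (j + 1) T' g + T g'\<close> reduces \<open>j + 1\<close> to \<open>j\<close> for a new argument \<open>X\<close>, which is killed by slightly
  fewer multipliers than \<open>g\<close>. This is why the bound grows by \<open>m\<close> with each \<open>j\<close>.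
\<close>

lemma phi_by_parts:
  fixes \<alpha> :: "nat \<Rightarrow> 'a::field_char_0" and m :: nat
  defines "T \<equiv> sing_poly \<alpha> m"
  assumes "annihilated \<alpha> m q (d + m * j) g"
    and "(s, a) \<in> polylog_index \<alpha> m (Suc q)" and "degree p < d"
  shows "phi (polylog_series s a) (p * (pderiv ^^ j) (T ^ j * g)) =
    (- 1) ^ j * phi (polylog_series s a) ((pderiv ^^ j) p * T ^ j * g)"
  using assms(2-)
proof (induction j arbitrary: g)
  case (Suc j)
  define X where "X = of_nat (Suc j) * (pderiv T * g) + T * pderiv g"
  have ann: "annihilated \<alpha> m q (d + m * j + m) g"
    using Suc.prems(1) by (simp add: algebra_simps)
  have dT: "degree T = Suc m" unfolding T_def by (rule degree_sing_poly)
  have der: "pderiv (T ^ Suc j * g) = T ^ j * X"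
    unfolding X_def pderiv_mult[of "T ^ Suc j"] pderiv_power_Suc
    by (simp add: of_nat_poly algebra_simps del: of_nat_Suc)
  have "annihilated \<alpha> m q (d + m * j) X"
    unfolding annihilated_def
  proof (safe)
    fix s a and p' :: "'a poly"
    assume sa: "(s, a) \<in> polylog_index \<alpha> m q" and p': "degree p' < d + m * j"
    have sa': "(s, a) \<in> polylog_index \<alpha> m (Suc q)"
      using sa by (auto simp: polylog_index_def)
    let ?\<phi> = "phi (polylog_series s a)"
    \<comment> \<open>\<open>T g'\<close> is traded for the derivative of \<open>T p' g\<close>, because nothing is known about \<open>g'\<close>.\<close>
    have eq: "p' * X = pderiv (T * p' * g) + smult (of_nat (Suc j) - 1) (p' * pderiv T * g)
        - pderiv p' * T * g"
      by (simp add: X_def pderiv_mult of_nat_poly algebra_simps smult_add_left)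
    have "?\<phi> (pderiv (T * p' * g)) = 0"
      unfolding T_def using ann sa' p' by (rule phi_pderiv_eq_0)
    moreover have "?\<phi> (p' * pderiv T * g) = 0"
    proof (rule annihilatedD[OF ann sa])
      show "degree (p' * pderiv T) < d + m * j + m"
        using degree_mult_le[of p' "pderiv T"] p' dT by (simp add: degree_pderiv)
    qed
    moreover have "?\<phi> (pderiv p' * T * g) = 0"
    proof (cases "degree p' = 0")
      case True
      then have "pderiv p' = 0" by (simp add: pderiv_eq_0_iff)
      then show ?thesis by simp
    next
      case False
      show ?thesis
      proof (rule annihilatedD[OF ann sa])
        show "degree (pderiv p' * T) < d + m * j + m"
          using degree_mult_le[of "pderiv p'" T] p' dT False by (simp add: degree_pderiv)
      qed
    qed
    ultimately show "?\<phi> (p' * X) = 0"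
      by (simp add: eq phi_add phi_diff phi_smult)
  qed
  then have "phi (polylog_series s a) (p * (pderiv ^^ j) (T ^ j * X)) =
      (- 1) ^ j * phi (polylog_series s a) ((pderiv ^^ j) p * T ^ j * X)"
    using Suc.IH Suc.prems by blast
  also have "(pderiv ^^ j) (T ^ j * X) = (pderiv ^^ Suc j) (T ^ Suc j * g)"
    by (simp only: funpow_Suc_right o_apply der)
  also have "phi (polylog_series s a) ((pderiv ^^ j) p * T ^ j * X) =
      - phi (polylog_series s a) ((pderiv ^^ Suc j) p * T ^ Suc j * g)"
  proof (cases "(pderiv ^^ j) p = 0")
    case False
    then have jp: "j \<le> degree p"
      using funpow_pderiv_eq_0[of p j] by (cases "j \<le> degree p") auto
    have "(pderiv ^^ j) p * T ^ j * X =
        pderiv (T * ((pderiv ^^ j) p * T ^ j) * g) - (pderiv ^^ Suc j) p * T ^ Suc j * g"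
    proof -
      have "T * ((pderiv ^^ j) p * T ^ j) * g = (pderiv ^^ j) p * (T ^ Suc j * g)" by simp
      then show ?thesis
        by (simp only: pderiv_mult[of "(pderiv ^^ j) p"] der) (simp add: mult_ac)
    qed
    moreover have "phi (polylog_series s a) (pderiv (T * ((pderiv ^^ j) p * T ^ j) * g)) = 0"
      unfolding T_def using ann Suc.prems(2)
    proof (rule phi_pderiv_eq_0)
      have "degree ((pderiv ^^ j) p * T ^ j) \<le> degree p - j + j * Suc m"
        using degree_mult_le[of "(pderiv ^^ j) p" "T ^ j"] degree_power_le[of T j]
        by (simp add: degree_funpow_pderiv dT mult.commute)
      then show "degree ((pderiv ^^ j) p * sing_poly \<alpha> m ^ j) < d + m * j"
        using jp Suc.prems(3) by (simp add: T_def algebra_simps)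
    qed
    ultimately show ?thesis by (simp only: phi_diff diff_0)
  qed simp
  finally show ?case by simp
qed simp

text \<open>The action of the formal adjoint of \<open>L_op\<close> on polynomials.\<close>

definition L_adj :: "(nat \<Rightarrow> 'a::field_char_0) \<Rightarrow> nat \<Rightarrow> nat \<Rightarrow> 'a poly \<Rightarrow> 'a poly" where
  "L_adj \<alpha> m N g = smult ((- 1) ^ N / fact N) ((pderiv ^^ N) (sing_poly \<alpha> m ^ N * g))"

text \<open>With \<open>N\<close> integrations by parts the multiplier, of degree below \<open>N\<close>, is differentiated to \<open>0\<close>.\<close>

lemma annihilated_L_adj:
  assumes "annihilated \<alpha> m q ((m + 1) * N) g"
  shows "annihilated \<alpha> m (Suc q) N (L_adj \<alpha> m N g)"
  unfolding annihilated_def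
proof safe
  fix s a and p :: "'a poly"
  assume sa: "(s, a) \<in> polylog_index \<alpha> m (Suc q)" and p: "degree p < N"
  have "annihilated \<alpha> m q (N + m * N) g" using assms by simp
  from phi_by_parts[OF this sa p] show "phi (polylog_series s a) (p * L_adj \<alpha> m N g) = 0"
    by (simp only: funpow_pderiv_eq_0[OF p] L_adj_def mult_smult_right phi_smult) simp
qed


section \<open>The adjoint reverses products\<close>

definition adj_act :: "'a::field_char_0 weyl \<Rightarrow> 'a poly \<Rightarrow> 'a poly" where
  "adj_act R = weyl_act (weyl_adjoint R)"

lemma weyl_act_sum: "weyl_act (sum f A) p = (\<Sum>x\<in>A. weyl_act (f x) p)"
  by (induction A rule: infinite_finite_induct) (auto simp: weyl_act_0 weyl_act_plus)

lemma weyl_act_D_power: "weyl_act (weyl_D ^ j) p = (pderiv ^^ j) p"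
  by (induction j arbitrary: p) (auto simp: weyl_act_1 weyl_act_mult weyl_act_D)

lemma adj_act_bound:
  assumes "degree A \<le> n"
  shows "adj_act (Weyl A) g = (\<Sum>j\<le>n. (- 1) ^ j * (pderiv ^^ j) (coeff A j * g))"
proof -
  have neg: "weyl_act ((- 1) ^ j * R) p = (- 1) ^ j * weyl_act R p" for j and R :: "'a weyl" and p
    by (induction j) (auto simp: weyl_act_mult weyl_act_uminus weyl_act_1)
  have "adj_act (Weyl A) g = (\<Sum>j\<le>degree A. (- 1) ^ j * (pderiv ^^ j) (coeff A j * g))"
    by (simp add: adj_act_def weyl_adjoint_def weyl_act_sum mult.assoc neg)
      (simp add: weyl_act_mult weyl_act_D_power weyl_act_of_poly)
  also have "\<dots> = (\<Sum>j\<le>n. (- 1) ^ j * (pderiv ^^ j) (coeff A j * g))"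
    by (rule sum.mono_neutral_left) (use assms in \<open>auto simp: coeff_eq_0 funpow_pderiv_0\<close>)
  finally show ?thesis .
qed

lemma adj_act_pCons: "adj_act (Weyl (pCons c A)) g = c * g - pderiv (adj_act (Weyl A) g)"
proof -
  have ps: "pderiv (sum h B) = (\<Sum>x\<in>B. pderiv (h x))" for h :: "nat \<Rightarrow> 'a poly" and B
    using funpow_pderiv_sum[of 1] by simp
  have pn: "pderiv ((- 1) ^ j * h) = (- 1) ^ j * pderiv h" for j and h :: "'a poly"
    by (induction j) (auto simp: pderiv_minus)
  have "adj_act (Weyl (pCons c A)) g =
      (\<Sum>j\<le>Suc (degree A). (- 1) ^ j * (pderiv ^^ j) (coeff (pCons c A) j * g))"
    by (rule adj_act_bound) (rule degree_pCons_le)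
  also have "\<dots> = c * g - pderiv (adj_act (Weyl A) g)"
    by (subst sum.atMost_Suc_shift)
      (simp add: adj_act_bound[of A, OF order_refl] ps pn sum_negf)
  finally show ?thesis .
qed

lemma adj_act_add: "adj_act (R + S) g = adj_act R g + adj_act S g"
proof (cases R; cases S)
  fix A B assume RS: "R = Weyl A" "S = Weyl B"
  let ?n = "max (degree A) (degree B)"
  have "degree (A + B) \<le> ?n" by (simp add: degree_add_le_max)
  then show ?thesis
    by (simp add: RS plus_weyl_def adj_act_bound[of _ ?n] algebra_simps sum.distrib funpow_pderiv_add)
qed

lemma weyl_act_pCons: "weyl_act (Weyl (pCons c A)) g = c * g + weyl_act (Weyl A) (pderiv g)"
proof -
  have "weyl_act (Weyl (pCons c A)) g =
      (\<Sum>j\<le>Suc (degree A). coeff (pCons c A) j * (pderiv ^^ j) g)"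
    by (rule weyl_act_bound) (rule degree_pCons_le)
  also have "\<dots> = c * g + weyl_act (Weyl A) (pderiv g)"
    by (subst sum.atMost_Suc_shift)
      (simp add: weyl_act_def funpow_Suc_right del: funpow.simps)
  finally show ?thesis .
qed

lemma weyl_of_poly_mult: "weyl_of_poly p * Weyl A = Weyl (smult p A)"
proof (rule weyl_act_inject, rule ext)
  fix g
  have "weyl_act (weyl_of_poly p * Weyl A) g = p * (\<Sum>j\<le>degree A. coeff A j * (pderiv ^^ j) g)"
    by (simp only: weyl_act_mult weyl_act_of_poly weyl_act_bound[OF order_refl])
  also have "\<dots> = weyl_act (Weyl (smult p A)) g"
    by (simp add: weyl_act_bound[OF degree_smult_le] sum_distrib_left mult.assoc)
  finally show "weyl_act (weyl_of_poly p * Weyl A) g = weyl_act (Weyl (smult p A)) g" .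
qed

text \<open>
  From \<open>\<partial> c = c' + c \<partial>\<close>; together with \<open>weyl_mult_D\<close> it lets left multiplication by \<open>\<partial>\<close> be treated by
  induction on the order of an operator.
\<close>

lemma weyl_D_mult_pCons: "weyl_D * Weyl (pCons c A) = Weyl [:pderiv c, c:] + (weyl_D * Weyl A) * weyl_D"
proof (rule weyl_act_inject, rule ext)
  fix g show "weyl_act (weyl_D * Weyl (pCons c A)) g =
      weyl_act (Weyl [:pderiv c, c:] + (weyl_D * Weyl A) * weyl_D) g"
    by (simp add: weyl_act_mult weyl_act_plus weyl_act_D weyl_act_pCons pderiv_add pderiv_mult
      weyl_act_0[unfolded zero_weyl_def])
qed

lemma weyl_mult_D: "Weyl A * weyl_D = Weyl (pCons 0 A)"
  by (rule weyl_act_inject) (simp add: fun_eq_iff weyl_act_mult weyl_act_D weyl_act_pCons)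

text \<open>
  Only left factors of the form \<open>p\<close> and \<open>\<partial>\<close> occur when the factors of \<open>R\<^sub>n\<close> are split off one by one
  from the left, so the rule \<open>(R S)\<^sup>* = S\<^sup>* R\<^sup>*\<close> is proved for these.
\<close>

lemma adj_act_of_poly_mult: "adj_act (weyl_of_poly p * R) g = adj_act R (p * g)"
proof (cases R)
  fix A assume R: "R = Weyl A"
  show ?thesis
    by (simp add: R weyl_of_poly_mult adj_act_bound[of "smult p A" "degree A"] degree_smult_le
      adj_act_bound[of A, OF order_refl] mult_ac)
qed

lemma adj_act_D_mult: "adj_act (weyl_D * R) g = - adj_act R (pderiv g)"
proof (cases R)
  fix A assume R: "R = Weyl A"
  have "adj_act (weyl_D * Weyl A) g = - adj_act (Weyl A) (pderiv g)"
  proof (induction A)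
    case 0
    have "weyl_D * Weyl 0 = (Weyl 0 :: 'a weyl)" by (simp flip: zero_weyl_def)
    then show ?case by (simp add: adj_act_bound[of 0 0])
  next
    case (pCons c A)
    obtain B where B: "weyl_D * Weyl A = Weyl B" by (cases "weyl_D * Weyl A")
    have z: "adj_act (Weyl 0) g = 0" by (simp add: adj_act_bound[of 0 0])
    show ?case
      using pCons.IH
      by (simp add: weyl_D_mult_pCons adj_act_add B weyl_mult_D adj_act_pCons pderiv_mult pderiv_minus z)
  qed
  then show ?thesis by (simp add: R)
qed

lemma adj_act_D_power_mult: "adj_act (weyl_D ^ N * R) g = (- 1) ^ N * adj_act R ((pderiv ^^ N) g)"
  by (induction N arbitrary: g)
    (auto simp: mult.assoc adj_act_D_mult funpow_Suc_right simp del: funpow.simps)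

lemma adj_act_smult: "adj_act R (smult c g) = smult c (adj_act R g)"
proof (cases R)
  fix A assume R: "R = Weyl A"
  show ?thesis unfolding R
    by (induction A) (auto simp: adj_act_pCons adj_act_bound[of 0 0] pderiv_smult smult_diff_right)
qed

lemma adj_act_L_op_mult: "adj_act (L_op \<alpha> m N * R) g = adj_act R (L_adj \<alpha> m N g)"
proof -
  have T: "monom 1 N * (\<Prod>i=1..m. [:- \<alpha> i, 1:] ^ N) = sing_poly \<alpha> m ^ N"
  proof -
    have "sing_poly \<alpha> m = monom 1 1 * (\<Prod>i=1..m. [:- \<alpha> i, 1:])" by (simp add: monom_Suc)
    then show ?thesis
      by (simp only: power_mult_distrib monom_power prod_power_distrib) simp
  qed
  have neg: "(- 1) ^ N * p = smult ((- 1) ^ N) p" for p :: "'a poly"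
    by (induction N) auto
  have sm: "(pderiv ^^ N) (smult c p) = smult c ((pderiv ^^ N) p)" for c and p :: "'a poly"
    by (induction N) (auto simp: pderiv_smult)
  show ?thesis
    unfolding L_op_def T
    by (simp add: mult.assoc adj_act_of_poly_mult adj_act_D_power_mult adj_act_smult L_adj_def neg sm
      del: mult_pCons_left)
qed

text \<open>
  The adjoint of the leftmost factor is applied first. Each factor trades a bound \<open>(m+1)\<^sup>k\<^sup>+\<^sup>1 n\<close> on the
  degree of the multipliers for \<open>(m+1)\<^sup>k n\<close> and gains one unit of weight.
\<close>

lemma annihilated_R_adj:
  assumes "k \<le> r" and "annihilated \<alpha> m (r - k) ((m + 1) ^ k * n) g"
  shows "annihilated \<alpha> m r n (adj_act (R_op \<alpha> m k n) g)"
  using assms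
proof (induction k arbitrary: g)
  case 0
  have "adj_act 1 g = g"
    by (simp add: one_weyl_def adj_act_bound[of 1 0])
  then show ?case using 0 by (simp add: R_op_def)
next
  case (Suc k)
  have eq: "R_op \<alpha> m (Suc k) n = L_op \<alpha> m ((m + 1) ^ k * n) * R_op \<alpha> m k n"
    by (simp add: R_op_def)
  have "Suc (r - Suc k) = r - k" using Suc.prems by simp
  moreover have "annihilated \<alpha> m (r - Suc k) ((m + 1) * ((m + 1) ^ k * n)) g"
    using Suc.prems by (simp add: algebra_simps)
  ultimately have "annihilated \<alpha> m (r - k) ((m + 1) ^ k * n) (L_adj \<alpha> m ((m + 1) ^ k * n) g)"
    by (metis annihilated_L_adj)
  then show ?case using Suc.IH Suc.prems by (simp add: eq adj_act_L_op_mult)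
qed


section \<open>The remainder of a Pade-type approximation\<close>

text \<open>
  \<open>(z\<^sup>i - t\<^sup>i) / (z - t)\<close> is the sum of all \<open>z\<^sup>a t\<^sup>b\<close> with \<open>a + b + 1 = i\<close>. The proof compares coefficients
  in the identity that characterizes the exact quotient.
\<close>

lemma coeff_divided_difference: "coeff (coeff (divided_difference P) b) a = coeff P (a + b + 1)"
proof (induction a arbitrary: b)
  define D where "D = divided_difference P"
  have "D * [:[:0, 1:], - 1:] = smult [:0, 1:] D - pCons 0 D"
    by (simp add: mult_pCons_right)
  then have "coeff (smult [:0, 1:] D - pCons 0 D) (Suc b) = coeff ([:P:] - map_poly (\<lambda>c. [:c:]) P) (Suc b)" for b
    using divided_difference_exact[of P] by (simp only: D_def)
  then have "pCons 0 (coeff D (Suc b)) - coeff D b = - [:coeff P (Suc b):]" for b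
    by (simp add: coeff_map_poly)
  then have *: "coeff D b = pCons (coeff P (Suc b)) (coeff D (Suc b))" for b
    by (metis (no_types) add_pCons add.right_neutral add_0 diff_eq_eq diff_minus_eq_add add_diff_cancel_left' uminus_add_conv_diff)
  {
    case 0 show ?case using *[of b] by (simp add: D_def)
  next
    case (Suc a) show ?case using *[of b] Suc[of "Suc b"] by (simp add: D_def)
  }
qed

lemma fls_nth_poly_at_infty: "fls_nth (poly_at_infty P) k = (if k \<le> 0 then coeff P (nat (- k)) else 0)"
proof (induction P arbitrary: k)
  case (pCons c P)
  have "poly_at_infty (pCons c P) = fls_const c + fls_X_inv * poly_at_infty P"
    using pCons by (simp add: poly_at_infty_def map_poly_pCons)
  then show ?case
    using pCons.IH by (auto simp: fls_X_inv_times_conv_shift coeff_pCons nat_diff_distrib split: nat.splits)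
qed (simp add: poly_at_infty_def)

lemma fls_nth_poly_at_infty_mult:
  assumes "degree P \<le> d"
  shows "fls_nth (poly_at_infty P * f) k = (\<Sum>i\<le>d. coeff P i * fls_nth f (k + int i))"
proof -
  have "fls_nth (poly_at_infty P * f) k = (\<Sum>i\<le>degree P. coeff P i * fls_nth f (k + int i))"
  proof (induction P arbitrary: k)
    case (pCons c P)
    have "poly_at_infty (pCons c P) * f = fls_const c * f + fls_X_inv * (poly_at_infty P * f)"
      using pCons by (simp add: poly_at_infty_def map_poly_pCons algebra_simps)
    then show ?case
      using pCons by (simp add: fls_X_inv_times_conv_shift sum.atMost_Suc_shift add_ac
         del: sum.atMost_Suc)
  qed (simp add: poly_at_infty_def)
  also have "\<dots> = (\<Sum>i\<le>d. coeff P i * fls_nth f (k + int i))"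
    by (rule sum.mono_neutral_left) (use assms in \<open>auto simp: coeff_eq_0\<close>)
  finally show ?thesis .
qed

lemma fls_nth_pade_remainder:
  fixes f :: "'a::field_char_0 fls" and P :: "'a poly"
  assumes f: "\<And>j. j \<le> 0 \<Longrightarrow> fls_nth f j = 0"
  defines "E \<equiv> poly_at_infty P * f - poly_at_infty (phi_ext f (divided_difference P))"
  shows "k \<le> 0 \<Longrightarrow> fls_nth E k = 0"
    and "fls_nth E (int j + 1) = phi f (monom 1 j * P)"
proof -
  let ?d = "degree P"
  have dd: "degree (divided_difference P) \<le> ?d"
    by (rule degree_le) (auto simp: poly_eq_iff coeff_divided_difference coeff_eq_0)
  have Q: "coeff (phi_ext f (divided_difference P)) a = (\<Sum>b\<le>?d. coeff P (a + b + 1) * fls_nth f (int b + 1))" for a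
  proof -
    have "phi_ext f (divided_difference P) =
        (\<Sum>b\<le>?d. coeff (divided_difference P) b * [:fls_nth f (int b + 1):])"
      unfolding phi_ext_def phi_monom mult_1
      by (rule sum.mono_neutral_left) (use dd in \<open>auto simp: coeff_eq_0\<close>)
    then show ?thesis by (simp add: coeff_sum coeff_divided_difference mult.commute)
  qed
  show "fls_nth E (int j + 1) = phi f (monom 1 j * P)"
  proof -
    have "fls_nth E (int j + 1) = (\<Sum>i\<le>?d. coeff P i * fls_nth f (int j + 1 + int i))"
      by (simp add: E_def fls_nth_poly_at_infty fls_nth_poly_at_infty_mult[OF order_refl])
    also have "\<dots> = phi f (\<Sum>i\<le>?d. monom 1 j * monom (coeff P i) i)"
      by (simp add: phi_sum mult_monom phi_monom add_ac)
    also have "\<dots> = phi f (monom 1 j * P)"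
      by (simp add: poly_as_sum_of_monoms flip: sum_distrib_left)
    finally show ?thesis .
  qed
  show "fls_nth E k = 0" if "k \<le> 0"
  proof -
    define a where "a = nat (- k)"
    have k: "k = - int a" using that by (simp add: a_def)
    \<comment> \<open>The terms with \<open>i \<le> a\<close> involve coefficients of \<open>f\<close> at nonpositive indices; the others are those of \<open>Q\<close>.\<close>
    define g where "g i = coeff P i * fls_nth f (k + int i)" for i
    have split: "sum g {..d + Suc a} = sum g {..a} + (\<Sum>b\<le>d. g (a + b + 1))" for d
      by (induction d) (auto simp: add_ac)
    have "fls_nth (poly_at_infty P * f) k = sum g {..?d + Suc a}"
      unfolding g_def by (rule fls_nth_poly_at_infty_mult) simp
    also have "sum g {..a} = 0"
      by (rule sum.neutral) (auto simp: g_def k f)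
    then have "sum g {..?d + Suc a} = (\<Sum>b\<le>?d. g (a + b + 1))"
      by (simp only: split add_0)
    also have "\<dots> = coeff (phi_ext f (divided_difference P)) a"
      unfolding Q by (simp add: g_def k add_ac)
    finally show ?thesis using that
      by (simp add: E_def fls_nth_poly_at_infty a_def)
  qed
qed

theorem corollary7p4:
  fixes \<alpha> :: "nat \<Rightarrow> 'a::field_char_0" and m r n l :: nat
  assumes "m \<ge> 1" and "r \<ge> 1"
    and "\<forall>i\<in>{1..m}. \<alpha> i \<noteq> 0"
    and "inj_on \<alpha> {1..m}"
  shows "pade_type_approximant n (polylog_index \<alpha> m r)
    (\<lambda>(s, a). polylog_series s a)
    (P_approx \<alpha> m r n l)
    (\<lambda>(s, a). Q_approx \<alpha> m r n s a l)"
proof -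
  let ?P = "P_approx \<alpha> m r n l"
  \<comment> \<open>There is no index of weight \<open>0\<close>, so any polynomial may start the descent.\<close>
  have "annihilated \<alpha> m 0 ((m + 1) ^ r * n) (monom 1 l)"
    by (simp add: annihilated_def polylog_index_0)
  then have ann: "annihilated \<alpha> m r n ?P"
    using annihilated_R_adj[of r r \<alpha> m n "monom 1 l"] by (simp add: P_approx_def adj_act_def)
  have "ord_infty (poly_at_infty ?P * polylog_series s a - poly_at_infty (Q_approx \<alpha> m r n s a l))
      \<ge> ereal (real n + 1)" if sa: "(s, a) \<in> polylog_index \<alpha> m r" for s a
  proof -
    define E where "E = poly_at_infty ?P * polylog_series s a - poly_at_infty (Q_approx \<alpha> m r n s a l)"
    note rem = fls_nth_pade_remainder[where f = "polylog_series s a" and P = ?P, folded Q_approx_def, folded E_def]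
    have "fls_nth E k = 0" if "k < int n + 1" for k
    proof (cases "k \<le> 0")
      case True
      then show ?thesis by (intro rem) (auto simp: fls_nth_polylog_series)
    next
      case False
      define j where "j = nat (k - 1)"
      have k: "k = int j + 1" "j < n" using False that by (auto simp: j_def)
      have "phi (polylog_series s a) (monom 1 j * ?P) = 0"
        using ann sa k by (intro annihilatedD) (auto simp: degree_monom_eq)
      then show ?thesis unfolding k by (subst rem) (auto simp: fls_nth_polylog_series)
    qed
    then have "E \<noteq> 0 \<Longrightarrow> int n + 1 \<le> fls_subdegree E" by (intro fls_subdegree_geI)
    then have "E \<noteq> 0 \<Longrightarrow> real n + 1 \<le> real_of_int (fls_subdegree E)" by linarith
    then show ?thesis by (simp add: ord_infty_def flip: E_def)
  qed
  moreover have "finite (polylog_index \<alpha> m r)"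
    using card_polylog_index[OF assms(4)] by blast
  ultimately show ?thesis
    unfolding pade_type_approximant_def
    by (intro conjI exI[of _ "max (card (polylog_index \<alpha> m r) * n) (degree ?P)"]) auto
qed

end
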